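(* Let $\beta,\gamma_0,\gamma$ satisfy $0<\beta<\frac{\pi}{2}$, $0<\gamma_0<2\sin\left(\frac{\beta}{2}\right)$ and $\gamma=2\arcsin\left(\frac{\gamma_0}{2}\right)<\beta$. Suppose that $$\kappa>\frac{\max_{j\in[N]}\|\Omega_j\|}{\tilde I(\gamma)\,\sin\left(2\sin\frac{\gamma}{2}\right)}\qquad\text{and}\qquad R_i^0\in B_{\gamma_0}\quad\text{for all } i\in[N].$$ Let $\{R_i\}_{i=1}^N$ be the global solution to the Winfree matrix model on $SO(n)$ (see context). Then $R_i(t)\in\overline{B_\gamma}$ for all $t\ge 0$ and all $i\in[N]$.
   Context: Let $[N]=\{1,\dots,N\}$, let $I_n$ be the $n\times n$ identity matrix, and let $\mathfrak{so}(n)$ be the space of real skew-symmetric $n\times n$ matrices. On $\mathbb{R}^{n\times n}$ use $\langle A,B\rangle=\frac12\operatorname{tr}(A^TB)$ and $\|A\|=\sqrt{\langle A,A\rangle}$. Let $d$ be the geodesic (Riemannian) distance on $SO(n)$ for the metric $\langle\cdot,\cdot\rangle$ restricted to tangent spaces; if $R\in SO(n)$ has eigenvalues $e^{\pm \mathrm{i}\theta_1},\dots,e^{\pm\mathrm{i}\theta_m},1,\dots,1$ with $\theta_j\in(0,\pi]$, then $d(I_n,R)=\sqrt{\sum_j\theta_j^2}$. Put $B_r=\{R\in SO(n): d(I_n,R)<r\}$ and $\overline{B_r}=\{R\in SO(n): d(I_n,R)\le r\}$. The Winfree matrix model on $SO(n)$ is $$\dot R_i=\Omega_iR_i+\frac{\kappa}{2}\Big(\frac1N\sum_{j=1}^N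 I(R_j)\Big)(I_n-R_i^2),\quad t>0,\qquad R_i(0)=R_i^0\in SO(n),\quad i\in[N],$$ with $\Omega_i\in\mathfrak{so}(n)$ and $\kappa>0$. Standing assumptions on the influence function $I$: $I(R)=\tilde I(d(I_n,R))$ for a function $\tilde I:[0,\lfloor n/2\rfloor\pi]\to\mathbb{R}_{\ge0}$ that is decreasing (non-increasing), satisfies $\lim_{r\to0^+}\tilde I(r)=1$, is globally Lipschitz continuous, and has support $\operatorname{supp}\tilde I=[0,\beta]$ with $0<\beta<\frac{\pi}{2}$. *)

theory Defs
  imports "HOL-Analysis.Analysis"
begin

definition mat_inner :: "real^'n^'n \<Rightarrow> real^'n^'n \<Rightarrow> real" where
  "mat_inner A B = trace (transpose A ** B) / 2"

definition mat_norm :: "real^'n^'n \<Rightarrow> real" where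
  "mat_norm A = sqrt (mat_inner A A)"

definition SO :: "(real^'n^'n) set" where
  "SO = {R. rotation_matrix R}"

definition skew_mats :: "(real^'n^'n) set" where
  "skew_mats = {A. transpose A = - A}"

(* Riemannian distance on SO(n): infimum of the lengths of the piecewise C1 curves in SO(n)
   joining A to B.  The library's piecewise C1 notion allows the speed to be unbounded near a
   breakpoint; using has_integral (rather than the total operator integral, which would return 0)
   discards the curves of infinite length. *)
definition geo_dist :: "real^'n^'n \<Rightarrow> real^'n^'n \<Rightarrow> real" where
  "geo_dist A B = Inf {L. \<exists>g. valid_path g \<and> path_image g \<subseteq> SO \<and>
      pathstart g = A \<and> pathfinish g = B \<and>
      ((\<lambda>t. mat_norm (vector_derivative g (at t))) has_integral L) {0..1}}"

definition geo_ball :: "real \<Rightarrow> (real^'n^'n) set" where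
  "geo_ball r = {R \<in> SO. geo_dist (mat 1) R < r}"

definition geo_cball :: "real \<Rightarrow> (real^'n^'n) set" where
  "geo_cball r = {R \<in> SO. geo_dist (mat 1) R \<le> r}"

(* Standing assumptions on the profile J of the influence function I(R) = J (d(I_n, R)) on SO(n).
   J is only considered on [0, floor(n/2) pi]; its values elsewhere are irrelevant. *)
definition influence_profile :: "nat \<Rightarrow> real \<Rightarrow> (real \<Rightarrow> real) \<Rightarrow> bool" where
  "influence_profile n \<beta> J \<longleftrightarrow>
     (let D = {0..real (n div 2) * pi} in
        (\<forall>r\<in>D. 0 \<le> J r) \<and>
        antimono_on D J \<and>
        (J \<longlongrightarrow> 1) (at 0 within (D \<inter> {0<..})) \<and>
        (\<exists>L. L-lipschitz_on D J) \<and>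
        closure {r \<in> D. J r \<noteq> 0} = {0..\<beta>})"

definition influence :: "(real \<Rightarrow> real) \<Rightarrow> real^'n^'n \<Rightarrow> real" where
  "influence J R = J (geo_dist (mat 1) R)"

(* Global solutions: curves in SO(n), continuous on [0, infinity), satisfying the equation for
   all t > 0.  Only the indices 1..N matter. *)
definition winfree_solution ::
    "nat \<Rightarrow> real \<Rightarrow> (real \<Rightarrow> real) \<Rightarrow> (nat \<Rightarrow> real^'n^'n) \<Rightarrow> (nat \<Rightarrow> real^'n^'n) \<Rightarrow>
     (nat \<Rightarrow> real \<Rightarrow> real^'n^'n) \<Rightarrow> bool" where
  "winfree_solution N \<kappa> J \<Omega> R0 R \<longleftrightarrow>
     (\<forall>i\<in>{1..N}.
        (\<forall>t\<ge>0. R i t \<in> SO) \<and>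
        continuous_on {0..} (R i) \<and>
        R i 0 = R0 i \<and>
        (\<forall>t>0. (R i has_vector_derivative
            (\<Omega> i ** R i t +
             (\<kappa> / 2 * (1 / real N * (\<Sum>j=1..N. influence J (R j t)))) *\<^sub>R
               (mat 1 - R i t ** R i t))) (at t)))"

end

theory Submission
  imports Defs
begin

text \<open>Let \<open>X = n - trace R\<close>, the squared norm of \<open>R - I\<close>.  The largest singular value of
  \<open>I - R\<close> has multiplicity at least two, which sharpens the obvious bound on \<open>trace (R\<^sup>2)\<close> to
  \<open>4 X - X\<^sup>2 \<le> n - trace (R\<^sup>2)\<close>.  This inequality is used twice.  Along the Cayley path from \<open>I\<close>
  to \<open>R\<close> it bounds the speed by the derivative of \<open>2 arcsin (\<surd>X / 2)\<close>, so the geodesic distance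
  is at most \<open>2 arcsin (\<surd>X / 2)\<close>; it is at least \<open>\<surd>X\<close>, the chord length.  Along the Winfree flow
  it shows that \<open>X\<close> decreases strictly at the first time some oscillator reaches
  \<open>X = \<gamma>\<^sub>0\<^sup>2 = (2 sin (\<gamma> / 2))\<^sup>2\<close>: at that time all oscillators are within distance \<open>\<gamma>\<close>, so the mean
  influence is at least \<open>J \<gamma>\<close>.  Hence \<open>X\<close> never reaches this level.\<close>

section \<open>Traces of orthogonal matrices\<close>

lemma matrix_inner_eq_trace:
  fixes A B :: "real^'n^'m"
  shows "A \<bullet> B = trace (transpose A ** B)"
  unfolding trace_def inner_vec_def matrix_matrix_mult_def transpose_def
  by (simp add: inner_vec_def) (rule sum.swap)

lemma trace_eq_inner: "trace A = mat 1 \<bullet> (A :: real^'n^'n)"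
  by (simp add: matrix_inner_eq_trace)

lemma trace_transpose: "trace (transpose A) = trace A"
  by (simp add: trace_def transpose_def)

lemma mat_norm_eq: "mat_norm A = norm A / sqrt 2"
  by (simp add: mat_norm_def mat_inner_def flip: matrix_inner_eq_trace)
    (simp add: real_sqrt_divide norm_eq_sqrt_inner)

lemma matrix_norm_sq_rows:
  fixes A :: "real^'n^'m"
  shows "(norm A)\<^sup>2 = (\<Sum>i\<in>UNIV. (norm (A $ i))\<^sup>2)"
  by (simp add: power2_norm_eq_inner inner_vec_def)

lemma norm_matrix_vector_sq:
  fixes A :: "real^'n^'m"
  shows "(norm (A *v x))\<^sup>2 = (\<Sum>i\<in>UNIV. (A $ i \<bullet> x)\<^sup>2)"
  by (subst power2_norm_eq_inner, subst inner_vec_def)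
    (simp add: matrix_vector_mul_component power2_eq_square)

lemma bounded_bilinear_matrix_mult:
  "bounded_bilinear ((**) :: real^'n^'m \<Rightarrow> real^'p^'n \<Rightarrow> real^'p^'m)"
proof (subst bilinear_conv_bounded_bilinear[symmetric], unfold bilinear_def, intro conjI allI)
  show "linear (\<lambda>B. A ** B)" for A :: "real^'n^'m"
    by (rule linearI)
      (simp_all add: vec_eq_iff matrix_matrix_mult_def sum.distrib ring_distribs
        sum_distrib_left mult.left_commute)
  show "linear (\<lambda>A. A ** B)" for B :: "real^'p^'n"
    by (rule linearI)
      (simp_all add: vec_eq_iff matrix_matrix_mult_def sum.distrib ring_distribs
        sum_distrib_left mult.assoc)
qed

interpretation matrix_mult:
  bounded_bilinear "(**) :: real^'n^'m \<Rightarrow> real^'p^'n \<Rightarrow> real^'p^'m"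
  by (rule bounded_bilinear_matrix_mult)

lemma orthogonal_matrix_inner:
  fixes Q :: "real^'n^'n"
  assumes "orthogonal_matrix Q"
  shows "(Q ** A) \<bullet> (Q ** B) = A \<bullet> (B :: real^'m^'n)"
proof -
  have "transpose A ** transpose Q ** (Q ** B) = transpose A ** ((transpose Q ** Q) ** B)"
    by (simp only: matrix_mul_assoc)
  also have "\<dots> = transpose A ** B"
    using assms by (simp add: orthogonal_matrix_def)
  finally show ?thesis
    by (simp add: matrix_inner_eq_trace matrix_transpose_mul)
qed

lemma orthogonal_matrix_norm:
  fixes Q :: "real^'n^'n"
  assumes "orthogonal_matrix Q"
  shows "norm (Q ** A) = norm (A :: real^'m^'n)"
  using orthogonal_matrix_inner[OF assms] by (simp add: norm_eq_sqrt_inner)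

lemma orthogonal_matrix_norm_vector:
  fixes Q :: "real^'n^'n"
  assumes "orthogonal_matrix Q"
  shows "norm (Q *v x) = norm x"
  using assms orthogonal_transformation_matrix[of "(*v) Q"]
  by (simp add: orthogonal_transformation_norm)

text \<open>This is the \<open>X\<close> of the overview. For a rotation with angles
  \<open>theta_j\<close> it is the sum of
  \<open>2 (1 - cos theta_j) = (2 sin (theta_j / 2))^2\<close>.\<close>

definition defect :: "real^'n^'n \<Rightarrow> real" where
  "defect R = real CARD('n) - trace R"

lemma orthogonal_matrix_self_inner:
  fixes R :: "real^'n^'n"
  assumes "orthogonal_matrix R"
  shows "R \<bullet> R = real CARD('n)"
  using assms by (simp add: matrix_inner_eq_trace orthogonal_matrix_def trace_I)

lemma norm_diff_mat_1:
  fixes R :: "real^'n^'n"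
  assumes "orthogonal_matrix R"
  shows "(norm (R - mat 1))\<^sup>2 = 2 * defect R"
  using orthogonal_matrix_self_inner[OF assms]
    orthogonal_matrix_self_inner[OF orthogonal_matrix_id, where 'n='n]
  by (simp add: power2_norm_eq_inner inner_diff inner_commute defect_def trace_eq_inner)

lemma mat_norm_diff_mat_1:
  assumes "orthogonal_matrix R"
  shows "mat_norm (R - mat 1) = sqrt (defect R)"
proof -
  have "norm (R - mat 1) = sqrt (2 * defect R)"
    using norm_diff_mat_1[OF assms] by (metis norm_ge_zero real_sqrt_unique)
  then show ?thesis
    by (simp add: mat_norm_eq real_sqrt_mult)
qed

lemma defect_nonneg:
  assumes "orthogonal_matrix R"
  shows "0 \<le> defect R"
  using norm_diff_mat_1[OF assms] zero_le_power2[of "norm (R - mat 1)"] by linarith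

section \<open>Singular values of \<open>I - R\<close> and the sharpened trace bound\<close>

lemma bessel_two:
  fixes c v w :: "'a::real_inner"
  assumes "v \<bullet> v = 1" "w \<bullet> w = 1" "v \<bullet> w = 0"
  shows "(c \<bullet> v)\<^sup>2 + (c \<bullet> w)\<^sup>2 \<le> (norm c)\<^sup>2"
proof -
  have "0 \<le> (c - (c \<bullet> v) *\<^sub>R v - (c \<bullet> w) *\<^sub>R w) \<bullet> (c - (c \<bullet> v) *\<^sub>R v - (c \<bullet> w) *\<^sub>R w)"
    by simp
  also have "\<dots> = (norm c)\<^sup>2 - (c \<bullet> v)\<^sup>2 - (c \<bullet> w)\<^sup>2"
    using assms
    by (simp add: inner_diff inner_commute power2_norm_eq_inner)
      (simp add: power2_eq_square algebra_simps)
  finally show ?thesis by simp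
qed

text \<open>The top singular value of \<open>I - R\<close> has multiplicity at least two: its singular space is
  \<open>R\<close>-invariant, and on a one-dimensional invariant space \<open>R\<close> acts as \<open>1\<close> or \<open>-1\<close>.\<close>

lemma orthogonal_matrix_double_singular_value:
  fixes R :: "real^'n^'n"
  assumes R: "orthogonal_matrix R" and neg: "\<And>v. R *v v = - v \<Longrightarrow> v = 0"
  obtains l where "0 \<le> l" "2 * l \<le> (norm (mat 1 - R))\<^sup>2"
    "\<And>x. (norm ((mat 1 - R) *v x))\<^sup>2 \<le> l * (norm x)\<^sup>2"
proof -
  define C where "C = mat 1 - R"
  have C: "C *v x = x - R *v x" for x
    by (simp add: C_def matrix_vector_mult_diff_rdistrib)
  have "continuous_on (sphere 0 1) (\<lambda>x. norm (C *v x))"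
    by (intro continuous_intros matrix_vector_mult_linear_continuous_on)
  moreover have "sphere (0::real^'n) 1 \<noteq> {}"
    by simp
  ultimately obtain v where v: "norm v = 1" and
    vmax: "\<And>x. norm x = 1 \<Longrightarrow> norm (C *v x) \<le> norm (C *v v)"
    using continuous_attains_sup[of "sphere (0::real^'n) 1" "\<lambda>x. norm (C *v x)"] by auto
  define l where "l = (norm (C *v v))\<^sup>2"
  have le: "(norm (C *v x))\<^sup>2 \<le> l * (norm x)\<^sup>2" for x
  proof (cases "x = 0")
    case False
    then have "norm (C *v (x /\<^sub>R norm x)) \<le> norm (C *v v)"
      by (intro vmax) simp
    then have "norm (C *v x) \<le> norm (C *v v) * norm x"
      using False by (simp add: matrix_vector_mult_scaleR divide_simps mult.commute)
    then have "(norm (C *v x))\<^sup>2 \<le> (norm (C *v v) * norm x)\<^sup>2"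
      by (rule power_mono) simp
    then show ?thesis
      by (simp add: l_def power_mult_distrib)
  qed simp
  \<comment> \<open>\<open>q\<close> is the quadratic form of \<open>l I - C^T C\<close>. Being
    nonnegative, it vanishes exactly on the top singular space of \<open>C\<close>.\<close>
  define q where "q x = l * (norm x)\<^sup>2 - (norm (C *v x))\<^sup>2" for x
  have q0: "0 \<le> q x" for x
    using le by (simp add: q_def)
  have par: "q (x + y) + q (x - y) = 2 * q x + 2 * q y" for x y
  proof -
    have parallelogram: "(norm (a + b))\<^sup>2 + (norm (a - b))\<^sup>2 = 2 * (norm a)\<^sup>2 + 2 * (norm b)\<^sup>2"
      for a b :: "real^'n"
      by (simp add: power2_norm_eq_inner inner_add inner_diff inner_commute)
    have "q (x + y) + q (x - y) = l * ((norm (x + y))\<^sup>2 + (norm (x - y))\<^sup>2)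
        - ((norm (C *v x + C *v y))\<^sup>2 + (norm (C *v x - C *v y))\<^sup>2)"
      unfolding q_def matrix_vector_right_distrib matrix_vector_mult_diff_distrib
      by (simp add: ring_distribs)
    then show ?thesis
      unfolding parallelogram by (simp add: q_def ring_distribs)
  qed
  have qv: "q v = 0"
    by (simp add: q_def l_def v)
  have qRv: "q (R *v v) = 0"
  proof -
    have "C *v (R *v v) = R *v (C *v v)"
      by (simp add: C matrix_vector_mult_diff_distrib)
    then show ?thesis
      by (simp add: q_def l_def v orthogonal_matrix_norm_vector[OF R])
  qed
  define w where "w = R *v v - (v \<bullet> (R *v v)) *\<^sub>R v"
  have vv: "v \<bullet> v = 1"
    using v by (simp add: dot_square_norm)
  have q_scale: "q (k *\<^sub>R x) = k\<^sup>2 * q x" for k x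
    by (simp add: q_def matrix_vector_mult_scaleR power_mult_distrib algebra_simps)
  \<comment> \<open>By the parallelogram law for \<open>q\<close>, the values at the sum and at the
    difference of two zeros of \<open>q\<close> add up to 0. Both are nonnegative, so both
    vanish.\<close>
  have qw: "q w = 0"
    using par[of "R *v v" "(v \<bullet> (R *v v)) *\<^sub>R v"] q0[of w]
      q0[of "R *v v + (v \<bullet> (R *v v)) *\<^sub>R v"]
    by (simp add: w_def q_scale qv qRv)
  have vw: "v \<bullet> w = 0"
    by (simp add: w_def inner_diff vv)
  have "2 * l \<le> (norm C)\<^sup>2"
  \<comment> \<open>If \<open>w = 0\<close>, then \<open>v\<close> is an eigenvector for 1, as
    \<open>neg\<close> excludes -1, so \<open>C *v v = 0\<close> and \<open>l = 0\<close>. Otherwise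
    \<open>v\<close> and the normalised \<open>w\<close> are two orthonormal top singular vectors,
    and Bessel's inequality is applied to each row of \<open>C\<close>.\<close>
  proof (cases "w = 0")
    case True
    then obtain c where c: "R *v v = c *\<^sub>R v"
      by (auto simp: w_def)
    have "\<bar>c\<bar> = 1"
      using orthogonal_matrix_norm_vector[OF R, of v] v by (simp add: c)
    moreover have "c \<noteq> - 1"
      using c neg[of v] v by auto
    ultimately have "R *v v = v"
      using c by (simp add: abs_if split: if_splits)
    then show ?thesis
      by (simp add: l_def C)
  next
    case False
    define u where "u = w /\<^sub>R norm w"
    have u: "u \<bullet> u = 1" "v \<bullet> u = 0"
      using False vw by (simp_all add: u_def dot_square_norm power2_eq_square)
    have "q u = 0"
      by (simp add: u_def q_scale qw)
    then have "2 * l = (norm (C *v v))\<^sup>2 + (norm (C *v u))\<^sup>2"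
      using u(1) by (simp add: q_def l_def power2_norm_eq_inner)
    also have "\<dots> = (\<Sum>i\<in>UNIV. (C $ i \<bullet> v)\<^sup>2 + (C $ i \<bullet> u)\<^sup>2)"
      by (simp add: norm_matrix_vector_sq sum.distrib)
    also have "\<dots> \<le> (\<Sum>i\<in>UNIV. (norm (C $ i))\<^sup>2)"
      by (intro sum_mono bessel_two vv u)
    finally show ?thesis
      by (simp add: matrix_norm_sq_rows)
  qed
  then show thesis
    using that[of l] le by (simp add: l_def C_def)
qed

text \<open>With \<open>C = I - R\<close>, the double singular value gives
  \<open>|C C|^2 \<le> l |C|^2 \<le> |C|^4 / 2 = 2 X^2\<close> in the Frobenius norm. Expanding the
  left side gives \<open>8 X - 2 (n - trace (R ** R))\<close>. Equality holds for a rotation in a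
  single plane.\<close>

lemma trace_square_bound:
  fixes R :: "real^'n^'n"
  assumes R: "orthogonal_matrix R" and neg: "\<And>v. R *v v = - v \<Longrightarrow> v = 0"
  shows "4 * defect R - (defect R)\<^sup>2 \<le> real CARD('n) - trace (R ** R)"
proof -
  define C where "C = mat 1 - R"
  obtain l where l: "0 \<le> l" "2 * l \<le> (norm C)\<^sup>2"
    and le: "\<And>x. (norm (C *v x))\<^sup>2 \<le> l * (norm x)\<^sup>2"
    using orthogonal_matrix_double_singular_value[OF assms] unfolding C_def by blast
  have nC: "(norm C)\<^sup>2 = 2 * defect R"
    using norm_diff_mat_1[OF R] by (simp add: C_def norm_minus_commute)
  have row: "(C ** C) $ i = transpose C *v (C $ i)" for i
    by (simp add: vec_eq_iff matrix_matrix_mult_def vector_matrix_mult_def mult.commute)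
  \<comment> \<open>The rows of \<open>C ** C\<close> are images under the transpose of
    \<open>C\<close>, while the bound \<open>le\<close> concerns \<open>C\<close>. Since
    \<open>R ** transpose C = - C\<close>, both have the same norms.\<close>
  have CT: "norm (transpose C *v x) = norm (C *v x)" for x
  proof -
    have "transpose C = mat 1 - transpose R"
      by (simp add: C_def transpose_def vec_eq_iff mat_def)
    then have "R ** transpose C = - C"
      using R by (simp add: C_def matrix_mult.diff_right orthogonal_matrix_def)
    then have "R *v (transpose C *v x) = (0 - C) *v x"
      unfolding matrix_vector_mul_assoc by simp
    then have "R *v (transpose C *v x) = - (C *v x)"
      by (simp only: matrix_vector_mult_diff_rdistrib) simp
    then show ?thesis
      by (metis norm_minus_cancel orthogonal_matrix_norm_vector[OF R])
  qed
  have "(norm (C ** C))\<^sup>2 \<le> (\<Sum>i\<in>UNIV. l * (norm (C $ i))\<^sup>2)"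
    unfolding matrix_norm_sq_rows row CT by (intro sum_mono le)
  also have "\<dots> = l * (2 * defect R)"
    by (simp add: nC flip: sum_distrib_left matrix_norm_sq_rows)
  also have "\<dots> \<le> 2 * (defect R)\<^sup>2"
    using l nC defect_nonneg[OF R]
    by (simp add: power2_eq_square mult.assoc[symmetric] mult_right_mono)
  finally have *: "(norm (C ** C))\<^sup>2 \<le> 2 * (defect R)\<^sup>2" .
  have CC: "C ** C = mat 1 - 2 *\<^sub>R R + R ** R"
    by (simp add: C_def matrix_mult.diff_right matrix_mult.diff_left scaleR_2)
  have n: "mat 1 \<bullet> (mat 1 :: real^'n^'n) = real CARD('n)"
    by (rule orthogonal_matrix_self_inner[OF orthogonal_matrix_id])
  have RR: "R \<bullet> (R ** R) = trace R"
    using orthogonal_matrix_inner[OF R, of "mat 1" R] by (simp add: trace_eq_inner)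
  have RRR: "(R ** R) \<bullet> (R ** R) = real CARD('n)"
    by (intro orthogonal_matrix_self_inner orthogonal_matrix_mul R)
  have "(norm (C ** C))\<^sup>2 = 6 * real CARD('n) + 2 * trace (R ** R) - 8 * trace R"
  proof -
    have "(norm (a - 2 *\<^sub>R b + c))\<^sup>2
        = a \<bullet> a + 4 * (b \<bullet> b) + c \<bullet> c - 4 * (a \<bullet> b) + 2 * (a \<bullet> c) - 4 * (b \<bullet> c)"
      for a b c :: "real^'n^'n"
      by (simp add: power2_norm_eq_inner inner_diff inner_add inner_commute)
    then show ?thesis
      unfolding CC by (simp add: n RR RRR orthogonal_matrix_self_inner[OF R] trace_eq_inner[symmetric] trace_I)
  qed
  then show ?thesis
    using * by (simp add: defect_def)
qed

section \<open>Lengths of paths\<close>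

definition path_lengths :: "real^'n^'n \<Rightarrow> real^'n^'n \<Rightarrow> real set" where
  "path_lengths A B = {L. \<exists>g. valid_path g \<and> path_image g \<subseteq> SO \<and>
      pathstart g = A \<and> pathfinish g = B \<and>
      ((\<lambda>t. mat_norm (vector_derivative g (at t))) has_integral L) {0..1}}"

lemma geo_dist_eq_Inf: "geo_dist A B = Inf (path_lengths A B)"
  by (simp add: geo_dist_def path_lengths_def)

text \<open>The fundamental theorem of calculus applies off the finitely many breakpoints, and the
  norm of an integral is at most the integral of the norm.\<close>

lemma mat_norm_diff_le_length:
  assumes "L \<in> path_lengths A B"
  shows "mat_norm (B - A) \<le> L"
proof -
  obtain g where g: "valid_path g" "g 0 = A" "g 1 = B"
    and L: "((\<lambda>t. mat_norm (vector_derivative g (at t))) has_integral L) {0..1}"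
    using assms by (auto simp: path_lengths_def pathstart_def pathfinish_def)
  obtain S where S: "finite S" "continuous_on {0..1} g" "g C1_differentiable_on {0..1} - S"
    using g(1) by (auto simp: valid_path_def piecewise_C1_differentiable_on_def)
  have "((\<lambda>t. vector_derivative g (at t)) has_integral (g 1 - g 0)) {0..1}"
    using S by (intro fundamental_theorem_of_calculus_interior_strong[of S])
      (auto simp: C1_differentiable_on_eq vector_derivative_works)
  moreover have "((\<lambda>t. norm (vector_derivative g (at t))) has_integral sqrt 2 * L) {0..1}"
    using has_integral_mult_right[OF L, of "sqrt 2"] by (simp add: mat_norm_eq)
  ultimately have "norm (g 1 - g 0) \<le> sqrt 2 * L"
    using integral_norm_bound_integral[of "\<lambda>t. vector_derivative g (at t)" "{0..1}"
        "\<lambda>t. norm (vector_derivative g (at t))"]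
    by (simp add: has_integral_iff)
  then show ?thesis
    by (simp add: mat_norm_eq g divide_le_eq mult.commute)
qed

lemma mat_norm_nonneg: "0 \<le> mat_norm A"
  by (simp add: mat_norm_eq)

text \<open>The infimum of an empty set of reals has no useful value, so a curve of finite length
  must exist. The next section provides one for every rotation.\<close>

lemma mat_norm_diff_le_geo_dist:
  assumes "path_lengths A B \<noteq> {}"
  shows "mat_norm (B - A) \<le> geo_dist A B"
  unfolding geo_dist_eq_Inf by (intro cInf_greatest assms mat_norm_diff_le_length)

lemma geo_dist_le_length:
  assumes "L \<in> path_lengths A B"
  shows "geo_dist A B \<le> L"
  unfolding geo_dist_eq_Inf using assms
  by (intro cInf_lower bdd_belowI[of _ "mat_norm (B - A)"] mat_norm_diff_le_length)

section \<open>Smooth paths of orthogonal matrices starting at the identity\<close>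

definition C1_orthogonal_path ::
    "(real \<Rightarrow> real^'n^'n) \<Rightarrow> (real \<Rightarrow> real^'n^'n) \<Rightarrow> bool" where
  "C1_orthogonal_path g g' \<longleftrightarrow>
     (\<forall>t. (g has_vector_derivative g' t) (at t)) \<and> continuous_on UNIV g' \<and>
     (\<forall>t. orthogonal_matrix (g t)) \<and> g 0 = mat 1"

lemma continuous_on_det:
  fixes f :: "'a::topological_space \<Rightarrow> real^'n^'n"
  assumes "continuous_on S f"
  shows "continuous_on S (\<lambda>t. det (f t))"
  unfolding det_def by (intro continuous_intros assms)

lemma C1_orthogonal_path_continuous:
  assumes "C1_orthogonal_path g g'"
  shows "continuous_on UNIV g"
  using assms
  by (auto simp: C1_orthogonal_path_def continuous_on_eq_continuous_at
      intro: has_vector_derivative_continuous)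

text \<open>The determinant is continuous on the connected real line, takes only the values 1 and
  -1, and equals 1 at time 0.\<close>

lemma C1_orthogonal_path_in_SO:
  assumes "C1_orthogonal_path g g'"
  shows "g t \<in> SO"
proof -
  have g0: "g 0 = mat 1" and orth: "orthogonal_matrix (g t)" for t
    using assms by (auto simp: C1_orthogonal_path_def)
  define D where "D = range (\<lambda>t. det (g t))"
  have "connected D"
    unfolding D_def
    by (intro connected_continuous_image continuous_on_det C1_orthogonal_path_continuous[OF assms])
      simp
  moreover have "D \<subseteq> {1, -1}"
    using det_orthogonal_matrix[OF orth] by (auto simp: D_def)
  then have "finite D"
    by (rule finite_subset) simp
  ultimately obtain d where d: "D = {d}"
    unfolding D_def using connected_finite_iff_sing by blast
  have "det (g 0) \<in> D" "det (g t) \<in> D"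
    by (simp_all add: D_def)
  then have "det (g t) = 1"
    using d g0 by (simp add: det_I)
  then show ?thesis
    using orth by (simp add: SO_def rotation_matrix_def)
qed

lemma C1_orthogonal_path_length:
  assumes g: "C1_orthogonal_path g g'"
    and L: "((\<lambda>t. mat_norm (g' t)) has_integral L) {0..1}"
  shows "L \<in> path_lengths (mat 1) (g 1)"
proof -
  have d: "(g has_vector_derivative g' t) (at t)" for t
    using g by (simp add: C1_orthogonal_path_def)
  have "g C1_differentiable_on {0..1}"
    using g by (auto simp: C1_orthogonal_path_def C1_differentiable_on_def
        intro!: exI[of _ g'] intro: continuous_on_subset)
  then have "valid_path g"
    unfolding valid_path_def by (rule C1_differentiable_imp_piecewise)
  moreover have "path_image g \<subseteq> SO"
    using C1_orthogonal_path_in_SO[OF g] by (auto simp: path_image_def)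
  moreover have "g 0 = mat 1"
    using g by (simp add: C1_orthogonal_path_def)
  ultimately show ?thesis
    using L by (auto simp: path_lengths_def pathstart_def pathfinish_def
        vector_derivative_at[OF d] intro!: exI[of _ g])
qed

lemma continuous_on_mat_norm:
  assumes "continuous_on S f"
  shows "continuous_on S (\<lambda>t. mat_norm (f t))"
  unfolding mat_norm_eq by (intro continuous_intros assms) auto

definition C1_reachable :: "(real^'n^'n) set" where
  "C1_reachable = {g 1 | g g'. C1_orthogonal_path g g'}"

lemma C1_reachableI: "C1_orthogonal_path g g' \<Longrightarrow> g 1 \<in> C1_reachable"
  by (auto simp: C1_reachable_def)

lemma path_lengths_nonempty:
  assumes "R \<in> C1_reachable"
  shows "path_lengths (mat 1) R \<noteq> {}"
proof -
  obtain g g' where g: "C1_orthogonal_path g g'" "R = g 1"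
    using assms by (auto simp: C1_reachable_def)
  have "(\<lambda>t. mat_norm (g' t)) integrable_on {0..1}"
    using g by (intro integrable_continuous_real continuous_on_mat_norm)
      (auto simp: C1_orthogonal_path_def intro: continuous_on_subset)
  then show ?thesis
    using C1_orthogonal_path_length[OF g(1)] g(2) by auto
qed

text \<open>The two paths are multiplied pointwise. Unlike concatenation, this creates no breakpoint
  and keeps the path \<open>C1\<close> on the whole real line.\<close>

lemma C1_reachable_mult:
  assumes "A \<in> C1_reachable" "B \<in> C1_reachable"
  shows "A ** B \<in> C1_reachable"
proof -
  obtain f f' where f: "C1_orthogonal_path f f'" "A = f 1"
    using assms(1) by (auto simp: C1_reachable_def)
  obtain g g' where g: "C1_orthogonal_path g g'" "B = g 1"
    using assms(2) by (auto simp: C1_reachable_def)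
  have "C1_orthogonal_path (\<lambda>t. f t ** g t) (\<lambda>t. f t ** g' t + f' t ** g t)"
    using f(1) g(1) C1_orthogonal_path_continuous[OF f(1)] C1_orthogonal_path_continuous[OF g(1)]
    by (auto simp: C1_orthogonal_path_def orthogonal_matrix_mul
        intro!: matrix_mult.has_vector_derivative matrix_mult.continuous_on continuous_on_add)
  from C1_reachableI[OF this] show ?thesis
    by (simp add: f(2) g(2))
qed

lemma C1_reachable_mat_1: "mat 1 \<in> C1_reachable"
proof -
  have "C1_orthogonal_path (\<lambda>t. mat 1) (\<lambda>t. 0)"
    by (auto simp: C1_orthogonal_path_def orthogonal_matrix_id)
  from C1_reachableI[OF this] show ?thesis .
qed

section \<open>Rectifiable connectedness of the rotation group\<close>

lemma orthogonal_matrixI_norm: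
  fixes M :: "real^'n^'n"
  assumes "\<And>x. norm (M *v x) = norm x"
  shows "orthogonal_matrix M"
  using orthogonal_transformation_matrix[of "(*v) M"] assms
  by (simp add: orthogonal_transformation)

lemma orthogonal_matrix_inner_vector:
  fixes Q :: "real^'n^'n"
  assumes "orthogonal_matrix Q"
  shows "(Q *v x) \<bullet> (Q *v y) = x \<bullet> y"
  using assms orthogonal_transformation_matrix[of "(*v) Q"]
  by (simp add: orthogonal_transformation_def)

lemma C1_reachable_subset_SO: "C1_reachable \<subseteq> SO"
  using C1_orthogonal_path_in_SO by (auto simp: C1_reachable_def)

lemma plane_rotation_reachable:
  fixes a c :: "real^'n"
  assumes ac: "a \<bullet> a = 1" "c \<bullet> c = 1" "a \<bullet> c = 0"
  obtains G where "G \<in> C1_reachable" "G *v a = cos \<theta> *\<^sub>R a + sin \<theta> *\<^sub>R c"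
    "\<And>x. a \<bullet> x = 0 \<Longrightarrow> c \<bullet> x = 0 \<Longrightarrow> G *v x = x"
proof -
  \<comment> \<open>\<open>P\<close> is the orthogonal projection onto the plane of \<open>a\<close>
    and \<open>c\<close>, and \<open>J\<close> is the quarter turn there taking \<open>a\<close> to
    \<open>c\<close>. As \<open>J ** J = - P\<close>, the path \<open>g\<close> below is
    \<open>exp (\<theta> t J)\<close> written out.\<close>
  define P where "P = (\<chi> i j. a $ i * a $ j + c $ i * c $ j)"
  define J where "J = (\<chi> i j. c $ i * a $ j - a $ i * c $ j)"
  have P: "P *v x = (a \<bullet> x) *\<^sub>R a + (c \<bullet> x) *\<^sub>R c" for x
    by (simp add: P_def vec_eq_iff matrix_vector_mult_def inner_vec_def sum_distrib_left
        sum.distrib ring_distribs ac_simps)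
  have J: "J *v x = (a \<bullet> x) *\<^sub>R c - (c \<bullet> x) *\<^sub>R a" for x
    by (simp add: J_def vec_eq_iff matrix_vector_mult_def inner_vec_def sum_distrib_left
        sum_subtractf ring_distribs ac_simps)
  define g where "g t = mat 1 + (cos (\<theta> * t) - 1) *\<^sub>R P + sin (\<theta> * t) *\<^sub>R J" for t
  define g' where "g' t = (- (\<theta> * sin (\<theta> * t))) *\<^sub>R P + (\<theta> * cos (\<theta> * t)) *\<^sub>R J" for t
  have g: "g t *v x = x + ((cos (\<theta> * t) - 1) * (a \<bullet> x) - sin (\<theta> * t) * (c \<bullet> x)) *\<^sub>R a
      + (sin (\<theta> * t) * (a \<bullet> x) + (cos (\<theta> * t) - 1) * (c \<bullet> x)) *\<^sub>R c" for t x
    by (simp add: g_def matrix_vector_mult_add_rdistrib P J algebra_simps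
        flip: scaleR_matrix_vector_assoc)
  have orth: "orthogonal_matrix (g t)" for t
  proof (rule orthogonal_matrixI_norm)
    fix x
    define p q where "p = (cos (\<theta> * t) - 1) * (a \<bullet> x) - sin (\<theta> * t) * (c \<bullet> x)"
      and "q = sin (\<theta> * t) * (a \<bullet> x) + (cos (\<theta> * t) - 1) * (c \<bullet> x)"
    have "g t *v x = x + p *\<^sub>R a + q *\<^sub>R c"
      by (simp add: g p_def q_def)
    then have "(g t *v x) \<bullet> (g t *v x)
        = x \<bullet> x + 2 * p * (a \<bullet> x) + 2 * q * (c \<bullet> x) + p\<^sup>2 + q\<^sup>2"
      using ac by (simp add: inner_add inner_commute) (simp add: power2_eq_square algebra_simps)
    also have "\<dots> = x \<bullet> x + ((a \<bullet> x)\<^sup>2 + (c \<bullet> x)\<^sup>2) * ((sin (\<theta> * t))\<^sup>2 + (cos (\<theta> * t))\<^sup>2 - 1)"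
      unfolding p_def q_def by (simp only: power2_eq_square) algebra
    finally show "norm (g t *v x) = norm x"
      by (simp add: norm_eq_sqrt_inner)
  qed
  have "C1_orthogonal_path g g'"
    unfolding C1_orthogonal_path_def
  proof (intro conjI allI orth)
    show "(g has_vector_derivative g' t) (at t)" for t
      unfolding g_def g'_def
      by (auto intro!: derivative_eq_intros simp: algebra_simps)
    show "continuous_on UNIV g'"
      unfolding g'_def by (intro continuous_intros)
    show "g 0 = mat 1"
      by (simp add: g_def)
  qed
  from C1_reachableI[OF this] show thesis
    by (rule that) (simp_all add: g ac inner_commute algebra_simps)
qed

text \<open>In general the rotation takes place in the plane spanned by \<open>a\<close> and
  \<open>b\<close>. The vector \<open>c\<close> serves the case \<open>b = - a\<close>, where these
  span no plane and a half turn in the plane of \<open>a\<close> and \<open>c\<close> is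
  used.\<close>

lemma unit_vector_rotation_reachable:
  fixes a b c :: "real^'n"
  assumes ab: "a \<bullet> a = 1" "b \<bullet> b = 1" and c: "c \<bullet> c = 1" "a \<bullet> c = 0"
  obtains G where "G \<in> C1_reachable" "G *v a = b"
    "\<And>x. a \<bullet> x = 0 \<Longrightarrow> b \<bullet> x = 0 \<Longrightarrow> c \<bullet> x = 0 \<Longrightarrow> G *v x = x"
proof -
  define u where "u = b - (a \<bullet> b) *\<^sub>R a"
  have au: "a \<bullet> u = 0"
    by (simp add: u_def inner_diff ab)
  have uu: "(a \<bullet> b)\<^sup>2 + (norm u)\<^sup>2 = 1"
    using ab by (simp add: u_def power2_norm_eq_inner inner_diff inner_commute)
      (simp add: power2_eq_square)
  show thesis
  proof (cases "u = 0")
    case True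
    then have b: "b = (a \<bullet> b) *\<^sub>R a" and "(a \<bullet> b)\<^sup>2 = 1"
      using uu by (simp_all add: u_def)
    then consider "b = a" | "b = - a"
      by (metis power2_eq_1_iff scaleR_minus1_left scaleR_one)
    then show thesis
    proof cases
      case 1
      then show thesis
        using that[OF C1_reachable_mat_1] by simp
    next
      case 2
      obtain G where "G \<in> C1_reachable" "G *v a = - a"
        "\<And>x. a \<bullet> x = 0 \<Longrightarrow> c \<bullet> x = 0 \<Longrightarrow> G *v x = x"
        using plane_rotation_reachable[OF ab(1) c, of pi] by auto
      then show thesis
        using that[of G] 2 by simp
    qed
  next
    case False
    define e where "e = u /\<^sub>R norm u"
    have e: "e \<bullet> e = 1" "a \<bullet> e = 0"
      using False au by (simp_all add: e_def dot_square_norm power2_eq_square)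
    obtain \<theta> where "a \<bullet> b = cos \<theta>" "norm u = sin \<theta>"
      using sincos_total_pi[of "norm u" "a \<bullet> b"] uu by auto
    then have "b = cos \<theta> *\<^sub>R a + sin \<theta> *\<^sub>R e"
      using False by (simp add: e_def u_def flip: \<open>norm u = sin \<theta>\<close>)
    then obtain G where G: "G \<in> C1_reachable" "G *v a = b"
      "\<And>x. a \<bullet> x = 0 \<Longrightarrow> e \<bullet> x = 0 \<Longrightarrow> G *v x = x"
      using plane_rotation_reachable[OF ab(1) e, of \<theta>] by auto
    have "e \<bullet> x = 0" if "a \<bullet> x = 0" "b \<bullet> x = 0" for x
      using that by (simp add: e_def u_def inner_diff_left)
    then show thesis
      using that[of G] G by blast
  qed
qed

lemma matrix_axis_component: "(M *v axis j 1) $ i = (M $ i $ j :: real)"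
  by (simp add: matrix_vector_mult_basis column_def)

text \<open>Induction on the set \<open>K\<close> of axes that may move. A reachable
  \<open>G\<close> that agrees with \<open>R\<close> on axis \<open>j\<close> and fixes every axis
  outside \<open>insert j K\<close> is split off; then \<open>transpose G ** R\<close> fixes axis
  \<open>j\<close> as well.\<close>

lemma SO_fixing_axes_imp_C1_reachable:
  fixes K :: "'n::finite set" and R :: "real^'n^'n"
  assumes "finite K" "R \<in> SO" "\<And>k. k \<notin> K \<Longrightarrow> R *v axis k 1 = axis k 1"
  shows "R \<in> C1_reachable"
  using assms
proof (induction K arbitrary: R rule: finite_induct)
  case empty
  then have "R = mat 1"
    by (simp add: vec_eq_iff mat_def axis_def flip: matrix_axis_component)
  then show ?case
    by (simp add: C1_reachable_mat_1)
next
  case (insert j K)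
  have R: "orthogonal_matrix R" "det R = 1"
    using insert.prems by (auto simp: SO_def rotation_matrix_def)
  have fixed: "R *v axis k 1 = axis k 1" if "k \<noteq> j" "k \<notin> K" for k
    using insert.prems that by auto
  have ax: "(axis k 1 :: real^'n) \<bullet> axis l 1 = (if k = l then 1 else 0)" for k l
    by (simp add: inner_axis_axis)
  have Raxis: "(R *v axis j 1) \<bullet> axis k 1 = 0" if "k \<noteq> j" "k \<notin> K" for k
    using orthogonal_matrix_inner_vector[OF R(1), of "axis j 1" "axis k 1"] fixed[OF that] that
    by (simp add: ax)
  show ?case
  \<comment> \<open>With only axis \<open>j\<close> free, \<open>R\<close> is diagonal and
    \<open>det R = 1\<close> forces its entry at \<open>j\<close> to be 1. Otherwise some axis
    \<open>l\<close> in \<open>K\<close> provides the spare direction for a possible half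
    turn.\<close>
  proof (cases "K = {}")
    case True
    have comp: "R $ i $ k = (if i = k then if k = j then R $ j $ j else 1 else 0)" for i k
    proof (cases "k = j")
      case True
      with Raxis[of i] \<open>K = {}\<close> show ?thesis
        by (auto simp: inner_axis matrix_axis_component)
    next
      case False
      then show ?thesis
        using fixed[of k] \<open>K = {}\<close> by (auto simp: axis_def simp flip: matrix_axis_component)
    qed
    have "det R = (\<Prod>i\<in>UNIV. R $ i $ i)"
      by (rule det_diagonal) (simp add: comp)
    also have "\<dots> = (\<Prod>i\<in>UNIV. if i = j then R $ j $ j else 1)"
      by (intro prod.cong refl) (simp add: comp[of _ _])
    finally have "R $ j $ j = 1"
      using R by simp
    then have "R = mat 1"
      unfolding vec_eq_iff mat_def by (subst comp) simp
    then show ?thesis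
      by (simp add: C1_reachable_mat_1)
  next
    case False
    then obtain l where l: "l \<in> K" "l \<noteq> j"
      using insert.hyps by auto
    have unit: "(R *v axis j 1) \<bullet> (R *v axis j 1) = 1"
      by (simp add: orthogonal_matrix_inner_vector[OF R(1)] ax)
    obtain G where G: "G \<in> C1_reachable" "G *v axis j 1 = R *v axis j 1"
      and Gfix: "\<And>x. axis j 1 \<bullet> x = 0 \<Longrightarrow> (R *v axis j 1) \<bullet> x = 0 \<Longrightarrow> axis l 1 \<bullet> x = 0
        \<Longrightarrow> G *v x = x"
      using unit_vector_rotation_reachable[of "axis j 1" "R *v axis j 1" "axis l 1"] unit l
      by (auto simp: ax)
    have GSO: "orthogonal_matrix G" "det G = 1"
      using G(1) C1_reachable_subset_SO by (auto simp: SO_def rotation_matrix_def)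
    define Q where "Q = transpose G ** R"
    have GG: "transpose G *v (G *v x) = x" for x
      using GSO(1) unfolding matrix_vector_mul_assoc by (simp add: orthogonal_matrix_def)
    have Q: "Q *v x = transpose G *v (R *v x)" for x
      by (simp add: Q_def matrix_vector_mul_assoc del: transpose_matrix_vector)
    have "Q \<in> SO"
      using R GSO by (simp add: SO_def rotation_matrix_def Q_def orthogonal_matrix_mul det_mul)
    moreover have "Q *v axis k 1 = axis k 1" if "k \<notin> K" for k
    proof (cases "k = j")
      case True
      then show ?thesis
        unfolding Q using GG[of "axis j 1"] G(2) by simp
    next
      case False
      then have "G *v axis k 1 = axis k 1"
        using that l by (intro Gfix Raxis) (auto simp: ax)
      then show ?thesis
        unfolding Q fixed[OF False that] using GG[of "axis k 1"] by simp
    qed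
    ultimately have "Q \<in> C1_reachable"
      by (intro insert.IH)
    moreover have "G ** Q = R"
      using GSO(1) unfolding Q_def matrix_mul_assoc by (simp add: orthogonal_matrix_def)
    ultimately show ?thesis
      using C1_reachable_mult[OF G(1)] by metis
  qed
qed

lemma SO_eq_C1_reachable: "(SO :: (real^'n^'n) set) = C1_reachable"
proof
  show "(SO :: (real^'n^'n) set) \<subseteq> C1_reachable"
    using SO_fixing_axes_imp_C1_reachable[of UNIV] by auto
qed (rule C1_reachable_subset_SO)

lemma sqrt_defect_le_geo_dist:
  assumes "R \<in> SO"
  shows "sqrt (defect R) \<le> geo_dist (mat 1) R"
  using mat_norm_diff_le_geo_dist[OF path_lengths_nonempty[of R]] assms
  by (simp add: SO_eq_C1_reachable[symmetric] SO_def rotation_matrix_def mat_norm_diff_mat_1)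

section \<open>The Cayley path\<close>

lemma inverse_if_injective:
  fixes A :: "real^'n^'n"
  assumes "\<And>x. A *v x = 0 \<Longrightarrow> x = 0"
  obtains B where "A ** B = mat 1" "B ** A = mat 1"
proof -
  obtain B where "B ** A = mat 1"
    using assms matrix_left_invertible_ker[of A] by blast
  then show thesis
    using that matrix_left_right_inverse by blast
qed

text \<open>The path is \<open>s \<mapsto> (I - s Z) (I + s Z)\<^sup>-\<^sup>1 = 2 Y - I\<close> with \<open>Z = (I - R) (I + R)\<^sup>-\<^sup>1\<close> and
  \<open>Y = (I + s Z)\<^sup>-\<^sup>1\<close>.  It is a reparametrised gradient flow line of the trace, which is why its
  velocity depends on \<open>s\<close> and the current point only.\<close>

lemma cayley_path:
  fixes R :: "real^'n^'n"
  assumes R: "orthogonal_matrix R" and neg: "\<And>v. R *v v = - v \<Longrightarrow> v = 0"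
  obtains g g' where "C1_orthogonal_path g g'" "g 1 = R"
    "\<And>s. s *\<^sub>R g' s = (1 / 2) *\<^sub>R (g s ** g s - mat 1)"
    "\<And>s v. g s *v v = - v \<Longrightarrow> v = 0"
    "\<And>s. g s = mat 1 \<Longrightarrow> s \<noteq> 0 \<Longrightarrow> R = mat 1"
proof -
  have "x = 0" if "(mat 1 + R) *v x = 0" for x
  proof (rule neg)
    show "R *v x = - x"
      using that by (simp add: matrix_vector_mult_add_rdistrib eq_neg_iff_add_eq_0 add.commute)
  qed
  then obtain B where B: "(mat 1 + R) ** B = mat 1" "B ** (mat 1 + R) = mat 1"
    using inverse_if_injective[of "mat 1 + R"] by blast
  define Z where "Z = (mat 1 - R) ** B"
  have ZR: "Z ** (mat 1 + R) = mat 1 - R"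
    by (simp add: Z_def B flip: matrix_mul_assoc)
  \<comment> \<open>With \<open>y = B *v x\<close>, the vectors \<open>x = y + R *v y\<close> and
    \<open>Z *v x = y - R *v y\<close> are orthogonal, because \<open>y\<close> and
    \<open>R *v y\<close> have equal length. Hence \<open>I + s Z\<close> is injective for every
    real \<open>s\<close>.\<close>
  have skew: "x \<bullet> (Z *v x) = 0" for x
  proof -
    define y where "y = B *v x"
    have x: "x = y + R *v y"
      using arg_cong[OF B(1), of "\<lambda>M. M *v x"]
      by (simp add: y_def matrix_vector_mult_add_rdistrib flip: matrix_vector_mul_assoc)
    have "Z *v x = y - R *v y"
      by (simp add: Z_def y_def matrix_vector_mult_diff_rdistrib flip: matrix_vector_mul_assoc)
    then show ?thesis
      unfolding x
      by (simp add: inner_add inner_diff orthogonal_matrix_inner_vector[OF R] inner_commute)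
  qed
  have sum_sq: "(norm (y + s *\<^sub>R (Z *v y)))\<^sup>2 = (norm y)\<^sup>2 + s\<^sup>2 * (norm (Z *v y))\<^sup>2"
    for s :: real and y
    using skew[of y]
    by (simp add: power2_norm_eq_inner inner_add inner_commute) (simp add: power2_eq_square)
  have "x = 0" if "(mat 1 + s *\<^sub>R Z) *v x = 0" for s :: real and x
  proof -
    have "x + s *\<^sub>R (Z *v x) = 0"
      using that by (simp add: matrix_vector_mult_add_rdistrib flip: scaleR_matrix_vector_assoc)
    then show ?thesis
      using sum_sq[of x s] by (simp add: add_nonneg_eq_0_iff)
  qed
  then have "\<exists>Y. (mat 1 + s *\<^sub>R Z) ** Y = mat 1 \<and> Y ** (mat 1 + s *\<^sub>R Z) = mat 1" for s :: real
    using inverse_if_injective[of "mat 1 + s *\<^sub>R Z"] by metis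
  then obtain Y where Y: "\<And>s. (mat 1 + s *\<^sub>R Z) ** Y s = mat 1" "\<And>s. Y s ** (mat 1 + s *\<^sub>R Z) = mat 1"
    by metis
  have Y_unique: "Y s = M" if "(mat 1 + s *\<^sub>R Z) ** M = mat 1" for s M
  proof -
    have "Y s = Y s ** ((mat 1 + s *\<^sub>R Z) ** M)"
      using that by simp
    also have "\<dots> = M"
      unfolding matrix_mul_assoc Y by simp
    finally show ?thesis .
  qed
  define g where "g s = 2 *\<^sub>R Y s - mat 1" for s
  have split: "x = Y s *v x + s *\<^sub>R (Z *v (Y s *v x))" for s x
    using arg_cong[OF Y(1)[of s], of "\<lambda>M. M *v x"]
    by (simp add: matrix_vector_mult_add_rdistrib flip: matrix_vector_mul_assoc scaleR_matrix_vector_assoc)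
  have gx: "g s *v x = 2 *\<^sub>R (Y s *v x) - x" for s x
    by (simp add: g_def matrix_vector_mult_diff_rdistrib flip: scaleR_matrix_vector_assoc)
  have orth: "orthogonal_matrix (g s)" for s
  proof (rule orthogonal_matrixI_norm)
    fix x
    define y where "y = Y s *v x"
    have x: "x = y + s *\<^sub>R (Z *v y)"
      using split[of x s] by (simp add: y_def)
    have "g s *v x = y + (- s) *\<^sub>R (Z *v y)"
      unfolding gx y_def[symmetric] by (subst x) (simp add: scaleR_2)
    then have "(norm (g s *v x))\<^sup>2 = (norm x)\<^sup>2"
      using sum_sq[of y s] sum_sq[of y "- s"] x by simp
    then show "norm (g s *v x) = norm x"
      by simp
  qed
  \<comment> \<open>\<open>Y s\<close> is the mean of \<open>I\<close> and the orthogonal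
    \<open>g s\<close>. This bound, uniform in \<open>s\<close>, makes the remainder in the
    derivative of \<open>Y\<close> quadratic without first proving \<open>Y\<close>
    continuous.\<close>
  have Y_contr: "norm (Y s ** W) \<le> norm W" for s and W :: "real^'n^'n"
  proof -
    have "2 *\<^sub>R (Y s ** W) = g s ** W + W"
      by (simp add: g_def matrix_mult.diff_left matrix_mult.scaleR_left)
    then have "2 * norm (Y s ** W) = norm (g s ** W + W)"
      by (metis norm_scaleR abs_numeral)
    also have "\<dots> \<le> 2 * norm W"
      using norm_triangle_ineq[of "g s ** W" W] by (simp add: orthogonal_matrix_norm[OF orth])
    finally show ?thesis by simp
  qed
  \<comment> \<open>The resolvent identity, which gives the derivative
    \<open>- Y Z Y\<close>.\<close>
  have Y_diff: "Y t - Y s = (s - t) *\<^sub>R (Y t ** (Z ** Y s))" for s t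
  proof -
    have "Y t ** ((mat 1 + s *\<^sub>R Z) - (mat 1 + t *\<^sub>R Z)) ** Y s = Y t - Y s"
      by (simp only: matrix_mult.diff_right matrix_mult.diff_left Y flip: matrix_mul_assoc)
        (simp add: Y matrix_mul_assoc)
    moreover have "(mat 1 + s *\<^sub>R Z) - (mat 1 + t *\<^sub>R Z) = (s - t) *\<^sub>R Z"
      by (simp add: scaleR_diff_left)
    ultimately show ?thesis
      by (simp add: matrix_mult.scaleR_left matrix_mult.scaleR_right matrix_mul_assoc)
  qed
  define Y' where "Y' s = - (Y s ** (Z ** Y s))" for s
  have Y': "(Y has_vector_derivative Y' s) (at s)" for s
    unfolding has_vector_derivative_def
  proof (rule has_derivativeI_sandwich[of 1])
    define W where "W = Z ** Y s"
    show "bounded_linear (\<lambda>x. x *\<^sub>R Y' s)"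
      by (rule bounded_linear_scaleR_left)
    show "((\<lambda>t. \<bar>t - s\<bar> * norm (W ** W)) \<longlongrightarrow> 0) (at s)"
      by (auto intro!: tendsto_eq_intros)
    show "norm (Y t - Y s - (t - s) *\<^sub>R Y' s) / norm (t - s) \<le> \<bar>t - s\<bar> * norm (W ** W)"
      if "t \<noteq> s" for t
    proof -
      have d: "Y t - Y s = (s - t) *\<^sub>R (Y t ** W)"
        by (simp only: Y_diff W_def)
      have "Y t - Y s - (t - s) *\<^sub>R Y' s = (s - t) *\<^sub>R (Y t ** W) + (t - s) *\<^sub>R (Y s ** W)"
        unfolding d by (simp add: Y'_def W_def)
      also have "\<dots> = (s - t) *\<^sub>R ((Y t - Y s) ** W)"
        by (simp add: matrix_mult.diff_left algebra_simps)
      also have "\<dots> = (t - s)\<^sup>2 *\<^sub>R (Y t ** (W ** W))"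
        unfolding d matrix_mult.scaleR_left scaleR_scaleR matrix_mul_assoc
        by (simp add: power2_commute[of t s] flip: power2_eq_square)
      finally have "norm (Y t - Y s - (t - s) *\<^sub>R Y' s) = (t - s)\<^sup>2 * norm (Y t ** (W ** W))"
        by simp
      also have "\<dots> \<le> (t - s)\<^sup>2 * norm (W ** W)"
        by (intro mult_left_mono Y_contr) simp
      finally have "norm (Y t - Y s - (t - s) *\<^sub>R Y' s) \<le> (t - s)\<^sup>2 * norm (W ** W)" .
      then show ?thesis
        using that by (simp add: divide_le_eq power2_eq_square abs_mult_self_eq ac_simps
            flip: abs_mult)
    qed
  qed simp
  have contY: "continuous_on UNIV Y"
    using Y' by (auto simp: continuous_on_eq_continuous_at intro: has_vector_derivative_continuous)
  define g' where "g' s = 2 *\<^sub>R Y' s" for s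
  have "C1_orthogonal_path g g'"
    unfolding C1_orthogonal_path_def
  proof (intro conjI allI orth)
    show "(g has_vector_derivative g' s) (at s)" for s
      unfolding g_def g'_def by (auto intro!: derivative_eq_intros Y')
    show "continuous_on UNIV g'"
      unfolding g'_def Y'_def by (intro continuous_intros matrix_mult.continuous_on contY)
    show "g 0 = mat 1"
      using Y_unique[of 0 "mat 1"] by (simp add: g_def scaleR_2)
  qed
  moreover have "g 1 = R"
  proof -
    have "2 *\<^sub>R B = (mat 1 + R) ** B + (mat 1 - R) ** B"
      by (simp add: scaleR_2 matrix_mult.diff_left matrix_mult.add_left)
    then have "mat 1 + Z = 2 *\<^sub>R B"
      by (simp add: B Z_def)
    then have "(mat 1 + 1 *\<^sub>R Z) ** ((1 / 2) *\<^sub>R (mat 1 + R)) = mat 1"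
      by (simp add: matrix_mult.scaleR_left matrix_mult.scaleR_right B)
    from Y_unique[OF this] show ?thesis
      by (simp add: g_def)
  qed
  \<comment> \<open>\<open>s Z Y = I - Y\<close> eliminates \<open>Z\<close> from
    \<open>s Y'\<close>. Keeping the factor \<open>s\<close> on the left makes the identity valid at
    \<open>s = 0\<close> too.\<close>
  moreover have "s *\<^sub>R g' s = (1 / 2) *\<^sub>R (g s ** g s - mat 1)" for s
  proof -
    have "Y s + s *\<^sub>R (Z ** Y s) = mat 1"
      using Y(1)[of s] by (simp add: matrix_mult.add_left matrix_mult.scaleR_left)
    then have "s *\<^sub>R (Z ** Y s) = mat 1 - Y s"
      by (simp add: algebra_simps)
    then have "s *\<^sub>R Y' s = - (Y s ** (mat 1 - Y s))"
      by (simp add: Y'_def flip: matrix_mult.scaleR_right)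
    moreover have "s *\<^sub>R g' s = 2 *\<^sub>R (s *\<^sub>R Y' s)"
      by (simp add: g'_def)
    ultimately have "s *\<^sub>R g' s = 2 *\<^sub>R (Y s ** Y s) - 2 *\<^sub>R Y s"
      by (simp add: matrix_mult.diff_right scaleR_diff_right)
    moreover have "g s ** g s - mat 1 = 4 *\<^sub>R (Y s ** Y s) - 4 *\<^sub>R Y s"
      by (simp add: g_def matrix_mult.diff_right matrix_mult.diff_left matrix_mult.scaleR_left
          matrix_mult.scaleR_right algebra_simps flip: scaleR_add_left)
    ultimately show ?thesis
      by (simp add: scaleR_diff_right)
  qed
  moreover have "v = 0" if "g s *v v = - v" for s v
    using that split[of v s] by (simp add: gx)
  moreover have "R = mat 1" if "g s = mat 1" "s \<noteq> 0" for s
  proof -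
    have "2 *\<^sub>R Y s = 2 *\<^sub>R mat 1"
      using that(1) by (simp add: g_def scaleR_2 algebra_simps)
    then have "Y s = mat 1"
      by simp
    then have "Z = 0"
      using Y(1)[of s] that(2) by simp
    then show ?thesis
      using ZR by simp
  qed
  ultimately show thesis
    using that by blast
qed

section \<open>The upper bound for the geodesic distance\<close>

lemma norm_matrix_vector_le:
  fixes A :: "real^'n^'m"
  shows "norm (A *v x) \<le> norm A * norm x"
proof -
  have "(norm (A *v x))\<^sup>2 \<le> (\<Sum>i\<in>UNIV. (norm (A $ i))\<^sup>2 * (norm x)\<^sup>2)"
    unfolding norm_matrix_vector_sq
    by (intro sum_mono) (metis Cauchy_Schwarz_ineq power2_norm_eq_inner)
  also have "\<dots> = (norm A * norm x)\<^sup>2"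
    by (simp add: matrix_norm_sq_rows power_mult_distrib sum_distrib_right)
  finally show ?thesis
    by (rule power2_le_imp_le) simp
qed

text \<open>\<open>R - mat 1\<close> doubles the length of an eigenvector for -1, so its norm would
  be at least 2, whereas the squared norm is \<open>2 * defect R < 4\<close>.\<close>

lemma not_neg_eigenvalue:
  fixes R :: "real^'n^'n"
  assumes R: "orthogonal_matrix R" and "defect R < 2" and v: "R *v v = - v"
  shows "v = 0"
proof (rule ccontr)
  assume "v \<noteq> 0"
  have "norm ((R - mat 1) *v v) \<le> norm (R - mat 1) * norm v"
    by (rule norm_matrix_vector_le)
  moreover have "(R - mat 1) *v v = - 2 *\<^sub>R v"
    by (simp add: matrix_vector_mult_diff_rdistrib v scaleR_2)
  ultimately have "2 \<le> norm (R - mat 1)"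
    using \<open>v \<noteq> 0\<close> by simp
  then have "2\<^sup>2 \<le> (norm (R - mat 1))\<^sup>2"
    by (rule power_mono) simp
  then show False
    using norm_diff_mat_1[OF R] assms(2) by simp
qed

text \<open>On the Cayley path let \<open>T = defect (g ** g)\<close>. Then
  \<open>s X' = T / 2\<close> and \<open>s\<close> times the speed is \<open>sqrt T / 2\<close>, so
  for \<open>0 < s < 1\<close> the speed is \<open>X' / sqrt T\<close>, at most
  \<open>X' / sqrt (4 X - X^2)\<close>. The latter is the derivative of
  \<open>2 arcsin (sqrt X / 2)\<close>.\<close>

lemma geo_dist_le_arcsin:
  fixes R :: "real^'n^'n"
  assumes R: "orthogonal_matrix R" and small: "defect R < 2"
  shows "geo_dist (mat 1) R \<le> 2 * arcsin (sqrt (defect R) / 2)"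
proof (cases "R = mat 1")
  case True
  have "C1_orthogonal_path (\<lambda>_. mat 1 :: real^'n^'n) (\<lambda>_. 0)"
    by (simp add: C1_orthogonal_path_def orthogonal_matrix_id)
  from C1_orthogonal_path_length[OF this, of 0] have "0 \<in> path_lengths (mat 1) R"
    by (simp add: True mat_norm_eq)
  then show ?thesis
    using geo_dist_le_length[of 0 "mat 1" R] by (simp add: True defect_def trace_I)
next
  case False
  obtain g g' where path: "C1_orthogonal_path g g'" and g1: "g 1 = R"
    and ode: "\<And>s. s *\<^sub>R g' s = (1 / 2) *\<^sub>R (g s ** g s - mat 1)"
    and neg: "\<And>s v. g s *v v = - v \<Longrightarrow> v = 0"
    and triv: "\<And>s. g s = mat 1 \<Longrightarrow> s \<noteq> 0 \<Longrightarrow> R = mat 1"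
    using cayley_path[OF R not_neg_eigenvalue[OF R small]] by blast
  have orth: "orthogonal_matrix (g s)" and g0: "g 0 = mat 1"
    and der: "(g has_vector_derivative g' s) (at s)" for s
    using path by (auto simp: C1_orthogonal_path_def)
  define X where "X s = defect (g s)" for s
  define T where "T s = defect (g s ** g s)" for s
  have X': "(X has_real_derivative - trace (g' s)) (at s)" for s
    using bounded_linear.has_vector_derivative[OF bounded_linear_inner_right der, of "mat 1" s]
    unfolding X_def defect_def trace_eq_inner
    by (auto simp: has_real_derivative_iff_has_vector_derivative intro!: derivative_eq_intros)
  have sX': "s * - trace (g' s) = T s / 2" for s
  proof -
    have "s * trace (g' s) = trace (s *\<^sub>R g' s)"
      by (simp add: trace_eq_inner)
    also have "\<dots> = (trace (g s ** g s) - real CARD('n)) / 2"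
      unfolding ode by (simp add: trace_eq_inner inner_diff) (simp add: trace_I flip: trace_eq_inner)
    finally show ?thesis
      by (simp add: T_def defect_def field_simps)
  qed
  have speed: "s * mat_norm (g' s) = sqrt (T s) / 2" if "0 \<le> s" for s
  proof -
    have "s * mat_norm (g' s) = mat_norm (s *\<^sub>R g' s)"
      using that by (simp add: mat_norm_eq)
    also have "\<dots> = mat_norm (g s ** g s - mat 1) / 2"
      unfolding ode by (simp add: mat_norm_eq)
    finally show ?thesis
      by (simp add: T_def mat_norm_diff_mat_1 orthogonal_matrix_mul orth)
  qed
  have T_nonneg: "0 \<le> T s" for s
    unfolding T_def by (intro defect_nonneg orthogonal_matrix_mul orth)
  have X_pos: "0 < X s" if "0 < s" for s
  proof -
    have "X s \<noteq> 0"
      using norm_diff_mat_1[OF orth, of s] triv[of s] that False by (auto simp: X_def)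
    then show ?thesis
      using defect_nonneg[OF orth, of s] by (simp add: X_def)
  qed
  \<comment> \<open>\<open>X\<close> is nondecreasing for positive \<open>s\<close>, because
    \<open>s X' = T / 2\<close> is nonnegative, and \<open>X 1 = defect R\<close>.\<close>
  have X_small: "X s < 2" if "0 < s" "s \<le> 1" for s
  proof -
    have "X s \<le> X 1"
    proof (rule DERIV_nonneg_imp_nondecreasing[OF that(2)])
      fix u assume "s \<le> u"
      then have "0 \<le> - trace (g' u)"
        using sX'[of u] T_nonneg[of u] that(1)
        by (metis divide_nonneg_nonneg less_le_trans linorder_not_le mult_pos_neg zero_le_numeral)
      then show "\<exists>y. (X has_real_derivative y) (at u) \<and> 0 \<le> y"
        using X' by blast
    qed
    then show ?thesis
      using small by (simp add: X_def g1)
  qed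
  have key: "4 * X s - (X s)\<^sup>2 \<le> T s" for s
    using trace_square_bound[OF orth neg, of s] by (simp add: X_def T_def defect_def)
  define \<phi> where "\<phi> s = 2 * arcsin (sqrt (X s) / 2)" for s
  define \<phi>' where "\<phi>' s = - trace (g' s) / sqrt (4 * X s - (X s)\<^sup>2)" for s
  have \<phi>': "(\<phi> has_real_derivative \<phi>' s) (at s)" if "0 < s" "s < 1" for s
  proof -
    have x: "0 < X s" "X s < 2"
      using X_pos X_small that by auto
    have "sqrt (X s) < sqrt 4"
      using x by (intro real_sqrt_less_mono) simp
    then have lt: "sqrt (X s) / 2 < 1"
      by simp
    have gt: "-1 < sqrt (X s) / 2"
      using x by (smt (verit) divide_nonneg_nonneg real_sqrt_ge_zero)
    have "sqrt (4 * X s - (X s)\<^sup>2) = sqrt (4 * X s * (1 - (sqrt (X s) / 2)\<^sup>2))"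
      using x by (simp add: power_divide power2_eq_square algebra_simps)
    also have "\<dots> = 2 * sqrt (X s) * sqrt (1 - (sqrt (X s) / 2)\<^sup>2)"
      by (simp add: real_sqrt_mult)
    finally have "\<phi>' s = 2 * (inverse (sqrt (1 - (sqrt (X s) / 2)\<^sup>2)) *
        (inverse (sqrt (X s)) / 2 * - trace (g' s) / 2))"
      by (simp add: \<phi>'_def divide_simps)
    then show ?thesis
      unfolding \<phi>_def using x lt gt
      by (auto intro!: derivative_eq_intros X')
  qed
  have "continuous_on {0..1} X"
    using X' by (meson DERIV_continuous continuous_at_imp_continuous_on)
  moreover have "X 0 = 0"
    by (simp add: X_def g0 defect_def trace_I)
  then have "X s \<le> 4" "0 \<le> X s" if "s \<in> {0..1}" for s
    using X_small[of s] X_pos[of s] that by (cases "s = 0"; simp)+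
  then have "- 1 \<le> sqrt (X s) / 2 \<and> sqrt (X s) / 2 \<le> 1" if "s \<in> {0..1}" for s
    using that real_sqrt_le_mono[of "X s" 4] by (force intro: order_trans[of _ 0])
  ultimately have cont: "continuous_on {0..1} \<phi>"
    unfolding \<phi>_def by (intro continuous_intros) auto
  \<comment> \<open>At 0 the quotient \<open>\<phi>'\<close> has denominator 0 and hence value 0,
    below the speed. Replacing the two endpoint values leaves the integral unchanged and allows a
    comparison on all of \<open>{0..1}\<close>.\<close>
  define \<psi> where "\<psi> s = (if s \<in> {0, 1} then mat_norm (g' s) else \<phi>' s)" for s
  have "(\<phi>' has_integral (\<phi> 1 - \<phi> 0)) {0..1}"
    using \<phi>' cont
    by (intro fundamental_theorem_of_calculus_interior)
      (auto simp flip: has_real_derivative_iff_has_vector_derivative)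
  then have \<psi>: "(\<psi> has_integral (\<phi> 1 - \<phi> 0)) {0..1}"
    by (rule has_integral_spike_finite[of "{0, 1}", rotated 2]) (auto simp: \<psi>_def)
  have "(\<lambda>t. mat_norm (g' t)) integrable_on {0..1}"
    using path by (intro integrable_continuous_real continuous_on_mat_norm)
      (auto simp: C1_orthogonal_path_def intro: continuous_on_subset)
  then obtain L where L: "((\<lambda>t. mat_norm (g' t)) has_integral L) {0..1}"
    by (auto simp: integrable_on_def)
  have "L \<le> \<phi> 1 - \<phi> 0"
  proof (rule has_integral_le[OF L \<psi>])
    fix s :: real assume s: "s \<in> {0..1}"
    show "mat_norm (g' s) \<le> \<psi> s"
    proof (cases "s \<in> {0, 1}")
      case False
      with s have s: "0 < s" "s < 1" by auto
      have pos: "0 < 4 * X s - (X s)\<^sup>2"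
        using X_pos[of s] X_small[of s] s by (simp add: power2_eq_square)
      then have T: "0 < T s" "sqrt (4 * X s - (X s)\<^sup>2) \<le> sqrt (T s)"
        using key[of s] by auto
      have "s * mat_norm (g' s) = (T s / 2) / sqrt (T s)"
        using s T by (simp add: speed real_div_sqrt)
      also have "\<dots> \<le> (T s / 2) / sqrt (4 * X s - (X s)\<^sup>2)"
        using T pos by (intro divide_left_mono) auto
      also have "\<dots> = s * \<phi>' s"
        by (simp add: \<phi>'_def sX'[symmetric])
      finally show ?thesis
        using s by (simp add: \<psi>_def)
    qed (simp add: \<psi>_def)
  qed
  moreover have "geo_dist (mat 1) R \<le> L"
    using geo_dist_le_length[OF C1_orthogonal_path_length[OF path L]] by (simp add: g1)
  ultimately show ?thesis
    by (simp add: \<phi>_def X_def g0 g1 defect_def trace_I)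
qed

section \<open>The Winfree flow\<close>

text \<open>A skew matrix pairs only with the skew part of \<open>R\<close>, so Cauchy-Schwarz can
  be applied to \<open>R - transpose R\<close>. Multiplying that by \<open>R\<close> preserves the
  norm and yields \<open>R ** R - mat 1\<close>.\<close>

lemma abs_trace_skew_le:
  fixes \<Omega> R :: "real^'n^'n"
  assumes \<Omega>: "\<Omega> \<in> skew_mats" and R: "orthogonal_matrix R"
  shows "\<bar>trace (\<Omega> ** R)\<bar> \<le> mat_norm \<Omega> * sqrt (defect (R ** R))"
proof -
  have skew: "transpose \<Omega> = - \<Omega>"
    using \<Omega> by (simp add: skew_mats_def)
  have 1: "\<Omega> \<bullet> R = - trace (\<Omega> ** R)"
    unfolding matrix_inner_eq_trace skew matrix_mult.minus_left
    by (simp add: trace_def sum_negf)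
  have "\<Omega> \<bullet> transpose R = trace (transpose \<Omega> ** transpose R)"
    by (rule matrix_inner_eq_trace)
  also have "\<dots> = trace (R ** \<Omega>)"
    unfolding matrix_transpose_mul[symmetric] by (rule trace_transpose)
  also have "\<dots> = trace (\<Omega> ** R)"
    by (rule trace_mul_sym)
  finally have 2: "\<Omega> \<bullet> transpose R = trace (\<Omega> ** R)" .
  have "norm (R - transpose R) = norm (R ** (R - transpose R))"
    by (simp add: orthogonal_matrix_norm[OF R])
  also have "\<dots> = norm (R ** R - mat 1)"
    using R by (simp add: matrix_mult.diff_right orthogonal_matrix_def)
  also have "\<dots> = sqrt 2 * mat_norm (R ** R - mat 1)"
    by (simp add: mat_norm_eq)
  also have "\<dots> = sqrt 2 * sqrt (defect (R ** R))"
    by (simp add: mat_norm_diff_mat_1 orthogonal_matrix_mul R)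
  finally have 3: "norm (R - transpose R) = sqrt 2 * sqrt (defect (R ** R))" .
  have "2 * \<bar>trace (\<Omega> ** R)\<bar> = \<bar>\<Omega> \<bullet> (R - transpose R)\<bar>"
    by (simp add: inner_diff_right 1 2)
  also have "\<dots> \<le> norm \<Omega> * norm (R - transpose R)"
    by (rule Cauchy_Schwarz_ineq2)
  also have "\<dots> = 2 * (mat_norm \<Omega> * sqrt (defect (R ** R)))"
    unfolding 3 mat_norm_eq by (simp add: field_simps)
  finally show ?thesis
    by simp
qed

text \<open>Here \<open>c\<close> stands for \<open>\<kappa>\<close> times the mean influence. With
  \<open>S = sqrt (defect (R ** R))\<close> the drift contributes at most
  \<open>mat_norm \<Omega> * S\<close> and the coupling exactly \<open>- c S^2 / 2\<close>. The
  trace bound gives \<open>S \<ge> 2 sin g\<close>, and \<open>sin g\<close> dominates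
  \<open>sin (2 sin (g / 2))\<close> since \<open>2 sin (g / 2) \<le> g < pi / 2\<close>.\<close>

lemma winfree_defect_derivative_neg:
  fixes \<Omega> R :: "real^'n^'n"
  assumes \<Omega>: "\<Omega> \<in> skew_mats" and R: "orthogonal_matrix R"
    and g: "0 < g" "g < pi / 2" and defect: "defect R = (2 * sin (g / 2))\<^sup>2"
    and c: "mat_norm \<Omega> < c * sin (2 * sin (g / 2))"
  shows "- trace (\<Omega> ** R + (c / 2) *\<^sub>R (mat 1 - R ** R)) < 0"
proof -
  define S where "S = sqrt (defect (R ** R))"
  have sin2: "2 * (sin (g / 2))\<^sup>2 = 1 - cos g"
    using cos_double_sin[of "g / 2"] by simp
  have "cos g > 0"
    using g by (intro cos_gt_zero) auto
  then have small: "defect R < 2"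
    unfolding defect using sin2 by (simp add: power_mult_distrib)
  have "defect R = 2 * (1 - cos g)"
    unfolding defect using sin2 by (simp add: power_mult_distrib)
  then have "4 * (sin g)\<^sup>2 = 4 * defect R - (defect R)\<^sup>2"
    by (simp add: sin_squared_eq) (simp add: power2_eq_square algebra_simps)
  also have "\<dots> \<le> defect (R ** R)"
    using trace_square_bound[OF R not_neg_eigenvalue[OF R small]] by (simp add: defect_def)
  finally have "(2 * sin g)\<^sup>2 \<le> defect (R ** R)"
    by (simp add: power_mult_distrib)
  then have S: "2 * sin g \<le> S"
    unfolding S_def by (rule real_le_rsqrt)
  have pos: "0 < sin g" "0 < sin (g / 2)"
    using g by (auto intro!: sin_gt_zero)
  have le: "2 * sin (g / 2) \<le> g"
    using sin_x_le_x[of "g / 2"] g by simp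
  have "0 < sin (2 * sin (g / 2))"
    using pos le g by (intro sin_gt_zero) auto
  moreover have "0 < c * sin (2 * sin (g / 2))"
    using c mat_norm_nonneg[of \<Omega>] by linarith
  ultimately have "0 < c"
    by (simp add: zero_less_mult_iff)
  have "mat_norm \<Omega> < c * sin (2 * sin (g / 2))"
    by (rule c)
  also have "\<dots> \<le> c * sin g"
    using \<open>0 < c\<close> le pos g by (intro mult_left_mono sin_monotone_2pi_le) auto
  also have "\<dots> \<le> c * (S / 2)"
    using \<open>0 < c\<close> S by (intro mult_left_mono) auto
  finally have "mat_norm \<Omega> * S < c / 2 * S * S"
    using pos S by (intro mult_strict_right_mono) auto
  moreover have "S * S = defect (R ** R)"
    using defect_nonneg[OF orthogonal_matrix_mul[OF R R]] by (simp add: S_def)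
  ultimately have "mat_norm \<Omega> * S < c / 2 * defect (R ** R)"
    by (simp add: mult.assoc)
  moreover have "- trace (\<Omega> ** R) \<le> mat_norm \<Omega> * S"
    using abs_trace_skew_le[OF \<Omega> R] by (simp add: S_def)
  moreover have "trace ((c / 2) *\<^sub>R (mat 1 - R ** R)) = c / 2 * defect (R ** R)"
    by (simp add: defect_def trace_eq_inner inner_diff_right)
      (simp add: trace_I flip: trace_eq_inner)
  ultimately show ?thesis
    by (simp add: trace_add)
qed

text \<open>At the first time some \<open>f j\<close> reaches \<open>b\<close>, continuity keeps all
  the others at most \<open>b\<close>, so \<open>der\<close> applies. A negative derivative there
  means that \<open>f j\<close> exceeded \<open>b\<close> just before, a contradiction. The bound on
  all functions at once is what a coupled system requires.\<close>

lemma first_hitting_time: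
  fixes f :: "'i \<Rightarrow> real \<Rightarrow> real"
  assumes "finite I" and cont: "\<And>i. i \<in> I \<Longrightarrow> continuous_on {0..} (f i)"
    and init: "\<And>i. i \<in> I \<Longrightarrow> f i 0 < b"
    and der: "\<And>i t. i \<in> I \<Longrightarrow> 0 < t \<Longrightarrow> (\<And>j. j \<in> I \<Longrightarrow> f j t \<le> b) \<Longrightarrow> f i t = b
      \<Longrightarrow> \<exists>d<0. (f i has_real_derivative d) (at t)"
    and i: "i \<in> I" "0 \<le> t"
  shows "f i t < b"
proof (rule ccontr)
  assume "\<not> f i t < b"
  define H where "H = (\<Union>i\<in>I. {t \<in> {0..}. b \<le> f i t})"
  have closed: "closed {t \<in> {0..}. f i t \<in> T}" if "i \<in> I" "closed T" for i T
    using continuous_closed_preimage[OF cont[OF that(1)] _ that(2)]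
    by (simp add: vimage_def Int_def)
  have "t \<in> H"
    using i \<open>\<not> f i t < b\<close> unfolding H_def by (intro UN_I[of i]) simp_all
  then have H: "H \<noteq> {}" "bdd_below H" "closed H"
    using closed[of _ "{b..}"] \<open>finite I\<close> unfolding H_def
    by (auto intro!: closed_UN bdd_belowI[of _ 0])
  define u where "u = Inf H"
  have "u \<in> H"
    unfolding u_def by (intro closed_contains_Inf H)
  then obtain j where j: "j \<in> I" "0 \<le> u" "b \<le> f j u"
    by (auto simp: H_def)
  have "0 < u"
    using j init[of j] by (cases "u = 0") auto
  have before: "f k s < b" if "k \<in> I" "0 \<le> s" "s < u" for k s
  proof (rule ccontr)
    assume "\<not> f k s < b"
    then have "s \<in> H"
      using that unfolding H_def by (intro UN_I[of k]) simp_all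
    then show False
      using cInf_lower[of s H] H that by (simp add: u_def)
  qed
  have "f k u \<le> b" if "k \<in> I" for k
  proof -
    have "closure {0..<u} \<subseteq> {t \<in> {0..}. f k t \<in> {..b}}"
      using before[OF that] closed[OF that, of "{..b}"]
      by (intro closure_minimal) (auto intro: less_imp_le)
    then show ?thesis
      using \<open>0 < u\<close> by (auto simp: subset_iff)
  qed
  then obtain d where "d < 0" "(f j has_real_derivative d) (at u)"
    using der[of j u] j \<open>0 < u\<close> by force
  then obtain e where e: "e > 0" "\<And>h. h > 0 \<Longrightarrow> h < e \<Longrightarrow> f j u < f j (u - h)"
    using DERIV_neg_dec_left[of "f j" d u] by blast
  \<comment> \<open>Small enough for the derivative estimate, and at most \<open>u\<close>, so that
    \<open>u - h\<close> is a nonnegative time.\<close>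
  define h where "h = min (e / 2) u"
  have "f j u < f j (u - h)"
    using e \<open>0 < u\<close> by (simp add: h_def)
  moreover have "f j (u - h) < b"
    using e \<open>0 < u\<close> j(1) by (intro before) (auto simp: h_def)
  ultimately show False
    using j by simp
qed

theorem proposition3p1:
  fixes N :: nat and \<kappa> \<beta> \<gamma>\<^sub>0 \<gamma> :: real and J :: "real \<Rightarrow> real"
    and \<Omega> R0 :: "nat \<Rightarrow> real^'n^'n" and R :: "nat \<Rightarrow> real \<Rightarrow> real^'n^'n"
  assumes "N \<ge> 1"
    and "\<kappa> > 0"
    and "\<And>i. i \<in> {1..N} \<Longrightarrow> \<Omega> i \<in> skew_mats"
    and "\<And>i. i \<in> {1..N} \<Longrightarrow> R0 i \<in> SO"
    and "0 < \<beta>" and "\<beta> < pi / 2"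
    and "influence_profile CARD('n) \<beta> J"
    and "0 < \<gamma>\<^sub>0" and "\<gamma>\<^sub>0 < 2 * sin (\<beta> / 2)"
    and "\<gamma> = 2 * arcsin (\<gamma>\<^sub>0 / 2)" and "\<gamma> < \<beta>"
    and "\<kappa> > Max ((\<lambda>j. mat_norm (\<Omega> j)) ` {1..N}) / (J \<gamma> * sin (2 * sin (\<gamma> / 2)))"
    and "\<And>i. i \<in> {1..N} \<Longrightarrow> R0 i \<in> geo_ball \<gamma>\<^sub>0"
    and "winfree_solution N \<kappa> J \<Omega> R0 R"
  shows "\<forall>t\<ge>0. \<forall>i\<in>{1..N}. R i t \<in> geo_cball \<gamma>"
proof -
  have SO: "R i t \<in> SO" and orth: "orthogonal_matrix (R i t)" if "i \<in> {1..N}" "0 \<le> t" for i t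
    using \<open>winfree_solution N \<kappa> J \<Omega> R0 R\<close> that
    by (auto simp: winfree_solution_def SO_def rotation_matrix_def)
  have \<gamma>\<^sub>0: "0 < \<gamma>\<^sub>0 / 2" "\<gamma>\<^sub>0 / 2 \<le> 1"
    using \<open>0 < \<gamma>\<^sub>0\<close> \<open>\<gamma>\<^sub>0 < 2 * sin (\<beta> / 2)\<close> sin_le_one[of "\<beta> / 2"] by linarith+
  have sin_half: "2 * sin (\<gamma> / 2) = \<gamma>\<^sub>0"
    using \<gamma>\<^sub>0 by (simp add: \<open>\<gamma> = 2 * arcsin (\<gamma>\<^sub>0 / 2)\<close>)
  have "0 < \<gamma>"
    using \<gamma>\<^sub>0 arcsin_less_arcsin[of 0 "\<gamma>\<^sub>0 / 2"] by (simp add: \<open>\<gamma> = 2 * arcsin (\<gamma>\<^sub>0 / 2)\<close>)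
  have "\<gamma> < pi / 2"
    using \<open>\<gamma> < \<beta>\<close> \<open>\<beta> < pi / 2\<close> by simp
  have "2 * (sin (\<gamma> / 2))\<^sup>2 = 1 - cos \<gamma>"
    using cos_double_sin[of "\<gamma> / 2"] by simp
  moreover have "cos \<gamma> > 0"
    using \<open>0 < \<gamma>\<close> \<open>\<gamma> < pi / 2\<close> by (intro cos_gt_zero) auto
  ultimately have "\<gamma>\<^sub>0\<^sup>2 < 2"
    by (simp add: sin_half[symmetric] power_mult_distrib)

  have dist_le: "geo_dist (mat 1) Q \<le> \<gamma>" if "Q \<in> SO" "defect Q \<le> \<gamma>\<^sub>0\<^sup>2" for Q :: "real^'n^'n"
  proof -
    have Q: "orthogonal_matrix Q"
      using that by (simp add: SO_def rotation_matrix_def)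
    have "sqrt (defect Q) \<le> \<gamma>\<^sub>0"
      using that \<open>0 < \<gamma>\<^sub>0\<close> by (intro real_le_lsqrt) auto
    then have "2 * arcsin (sqrt (defect Q) / 2) \<le> \<gamma>"
      unfolding \<open>\<gamma> = 2 * arcsin (\<gamma>\<^sub>0 / 2)\<close>
      using defect_nonneg[OF Q] \<gamma>\<^sub>0
      by (intro mult_left_mono arcsin_le_arcsin) (auto intro: order_trans[of _ 0])
    moreover have "geo_dist (mat 1) Q \<le> 2 * arcsin (sqrt (defect Q) / 2)"
      using Q that \<open>\<gamma>\<^sub>0\<^sup>2 < 2\<close> by (intro geo_dist_le_arcsin) auto
    ultimately show ?thesis
      by simp
  qed

  define D where "D = {0..real (CARD('n) div 2) * pi}"
  have J_mono: "antimono_on D J" and J_supp: "closure {r \<in> D. J r \<noteq> 0} = {0..\<beta>}"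
    and J_nonneg: "\<forall>r\<in>D. 0 \<le> J r"
    using \<open>influence_profile CARD('n) \<beta> J\<close> by (auto simp: influence_profile_def D_def Let_def)
  \<comment> \<open>The support is a closure, so \<open>J \<beta>\<close> itself may vanish. A point
    \<open>r\<close> of \<open>D\<close> beyond \<open>\<gamma>\<close> with
    \<open>J r \<noteq> 0\<close> yields both \<open>{0..\<gamma>} \<subseteq> D\<close> and
    \<open>0 < J \<gamma>\<close>.\<close>
  have "\<beta> \<in> closure {r \<in> D. J r \<noteq> 0}"
    using J_supp \<open>0 < \<beta>\<close> by simp
  moreover have "0 < \<beta> - \<gamma>"
    using \<open>\<gamma> < \<beta>\<close> by simp
  ultimately obtain r where r: "r \<in> D" "J r \<noteq> 0" "dist r \<beta> < \<beta> - \<gamma>"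
    unfolding closure_approachable by blast
  then have "\<gamma> < r"
    by (auto simp: dist_real_def)
  then have sub: "{0..\<gamma>} \<subseteq> D"
    using r by (auto simp: D_def)
  have "J r \<le> J \<gamma>"
    using r(1) \<open>\<gamma> < r\<close> sub \<open>0 < \<gamma>\<close> by (intro monotone_onD[OF J_mono]) auto
  then have "0 < J \<gamma>"
    using J_nonneg r(1,2) by force
  have J_ge: "J \<gamma> \<le> influence J Q" if "Q \<in> SO" "defect Q \<le> \<gamma>\<^sub>0\<^sup>2" for Q :: "real^'n^'n"
  proof -
    have "0 \<le> sqrt (defect Q)"
      using that defect_nonneg[of Q] by (simp add: SO_def rotation_matrix_def)
    \<comment> \<open>\<open>J\<close> is controlled only on \<open>D\<close>, so the distance must
      also be known to be nonnegative; the chord bound supplies this.\<close>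
    then have "geo_dist (mat 1) Q \<in> {0..\<gamma>}"
      unfolding atLeastAtMost_iff
      using sqrt_defect_le_geo_dist[OF that(1)] dist_le[OF that] by linarith
    then show ?thesis
      unfolding influence_def using sub \<open>0 < \<gamma>\<close> by (intro monotone_onD[OF J_mono]) auto
  qed
  have "0 < sin \<gamma>\<^sub>0"
    using \<open>0 < \<gamma>\<^sub>0\<close> sin_half \<open>0 < \<gamma>\<close> \<open>\<gamma> < pi / 2\<close> sin_x_le_x[of "\<gamma> / 2"]
    by (intro sin_gt_zero) auto
  have \<Omega>_less: "mat_norm (\<Omega> i) < \<kappa> * J \<gamma> * sin \<gamma>\<^sub>0" if "i \<in> {1..N}" for i
  proof -
    have "mat_norm (\<Omega> i) \<le> Max ((\<lambda>j. mat_norm (\<Omega> j)) ` {1..N})"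
      using that by (intro Max_ge) auto
    also have "\<dots> < \<kappa> * (J \<gamma> * sin \<gamma>\<^sub>0)"
      using assms(12) \<open>0 < J \<gamma>\<close> \<open>0 < sin \<gamma>\<^sub>0\<close> by (simp add: sin_half divide_less_eq)
    finally show ?thesis
      by (simp add: mult.assoc)
  qed

  have defect_less: "defect (R i t) < \<gamma>\<^sub>0\<^sup>2" if "i \<in> {1..N}" "0 \<le> t" for i t
  proof (rule first_hitting_time[where I = "{1..N}" and f = "\<lambda>i t. defect (R i t)"])
    show "continuous_on {0..} (\<lambda>t. defect (R j t))" if "j \<in> {1..N}" for j
      using \<open>winfree_solution N \<kappa> J \<Omega> R0 R\<close> that
      unfolding defect_def trace_eq_inner
      by (intro continuous_intros) (auto simp: winfree_solution_def)
    \<comment> \<open>The chord is at most the geodesic distance, which is initially below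
      \<open>\<gamma>\<^sub>0\<close>.\<close>
    show "defect (R j 0) < \<gamma>\<^sub>0\<^sup>2" if j: "j \<in> {1..N}" for j
    proof -
      have "R j 0 = R0 j"
        using \<open>winfree_solution N \<kappa> J \<Omega> R0 R\<close> j by (auto simp: winfree_solution_def)
      then have "sqrt (defect (R j 0)) < \<gamma>\<^sub>0"
        using sqrt_defect_le_geo_dist[OF SO[OF j order_refl]] assms(13)[OF j]
        by (simp add: geo_ball_def)
      then show ?thesis
        using real_sqrt_less_iff[of _ "\<gamma>\<^sub>0\<^sup>2"] \<open>0 < \<gamma>\<^sub>0\<close> by simp
    qed
    show "\<exists>d<0. ((\<lambda>t. defect (R j t)) has_real_derivative d) (at s)"
      if j: "j \<in> {1..N}" and s: "0 < s" and le: "\<And>k. k \<in> {1..N} \<Longrightarrow> defect (R k s) \<le> \<gamma>\<^sub>0\<^sup>2"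
        and eq: "defect (R j s) = \<gamma>\<^sub>0\<^sup>2" for j s
    proof -
      \<comment> \<open>At a hitting time every oscillator satisfies the defect bound, so each
        influence, and hence their mean, is at least \<open>J \<gamma>\<close>.\<close>
      define c where "c = \<kappa> * (1 / real N * (\<Sum>k=1..N. influence J (R k s)))"
      have "real N * J \<gamma> = (\<Sum>k=1..N. J \<gamma>)"
        by simp
      also have "\<dots> \<le> (\<Sum>k=1..N. influence J (R k s))"
        using le s by (intro sum_mono J_ge SO) auto
      finally have "J \<gamma> \<le> 1 / real N * (\<Sum>k=1..N. influence J (R k s))"
        using \<open>N \<ge> 1\<close> by (simp add: field_simps)
      then have "\<kappa> * J \<gamma> * sin \<gamma>\<^sub>0 \<le> c * sin \<gamma>\<^sub>0"
        using \<open>\<kappa> > 0\<close> \<open>0 < sin \<gamma>\<^sub>0\<close> unfolding c_def by (intro mult_right_mono mult_left_mono) auto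
      then have "mat_norm (\<Omega> j) < c * sin (2 * sin (\<gamma> / 2))"
        using \<Omega>_less[OF j] by (simp add: sin_half)
      moreover have "defect (R j s) = (2 * sin (\<gamma> / 2))\<^sup>2"
        by (simp add: sin_half eq)
      ultimately have neg: "- trace (\<Omega> j ** R j s + (c / 2) *\<^sub>R (mat 1 - R j s ** R j s)) < 0"
        using \<open>0 < \<gamma>\<close> \<open>\<gamma> < pi / 2\<close> orth[OF j] s assms(3)[OF j]
        by (intro winfree_defect_derivative_neg) auto
      have "c / 2 = \<kappa> / 2 * (1 / real N * (\<Sum>k=1..N. influence J (R k s)))"
        by (simp add: c_def)
      then have "(R j has_vector_derivative
          (\<Omega> j ** R j s + (c / 2) *\<^sub>R (mat 1 - R j s ** R j s))) (at s)"
        using \<open>winfree_solution N \<kappa> J \<Omega> R0 R\<close> j s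
        unfolding winfree_solution_def by metis
      from bounded_linear.has_vector_derivative[OF bounded_linear_inner_right this, of "mat 1"]
      have "((\<lambda>t. defect (R j t)) has_real_derivative
          - trace (\<Omega> j ** R j s + (c / 2) *\<^sub>R (mat 1 - R j s ** R j s))) (at s)"
        unfolding defect_def trace_eq_inner has_real_derivative_iff_has_vector_derivative
        by (auto intro!: derivative_eq_intros)
      with neg show ?thesis
        by blast
    qed
  qed (use that in auto)
  show ?thesis
    using SO dist_le[OF SO less_imp_le[OF defect_less]] by (auto simp: geo_cball_def)
qed

end
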